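(* Let $(L,\cdot,\alpha)$ be a (left) Hom-Leibniz algebra over a field $\mathbb{K}$ of characteristic $0$, and put $[x,y] := x\cdot y - y\cdot x$ for $x,y\in L$. Then for all $x,y,z\in L$: (i) $(x\cdot y + y\cdot x)\cdot \alpha(z) = 0$; (ii) $\alpha(x)\cdot [y,z] = [x\cdot y,\alpha(z)] + [\alpha(y), x\cdot z]$.
   Context: A Hom-algebra is a triple $(A,\cdot,\alpha)$ where $A$ is a $\mathbb{K}$-vector space, $\cdot$ is a bilinear binary operation on $A$, and $\alpha: A\to A$ is a linear map that is multiplicative: $\alpha(x\cdot y)=\alpha(x)\cdot\alpha(y)$ for all $x,y\in A$. A (left) Hom-Leibniz algebra is a Hom-algebra $(A,\cdot,\alpha)$ such that $\alpha(x)\cdot(y\cdot z) = (x\cdot y)\cdot\alpha(z) + \alpha(y)\cdot(x\cdot z)$ for all $x,y,z\in A$. *)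

theory Defs
  imports Complex_Main
begin

locale hom_algebra = vector_space scale
  for scale :: "'k::field \<Rightarrow> 'a::ab_group_add \<Rightarrow> 'a" +
  fixes mult :: "'a \<Rightarrow> 'a \<Rightarrow> 'a"
    and \<alpha> :: "'a \<Rightarrow> 'a"
  assumes linear_mult_left: "Vector_Spaces.linear scale scale (\<lambda>x. mult x y)"
    and linear_mult_right: "Vector_Spaces.linear scale scale (\<lambda>y. mult x y)"
    and linear_twist: "Vector_Spaces.linear scale scale \<alpha>"
    and twist_mult: "\<alpha> (mult x y) = mult (\<alpha> x) (\<alpha> y)"

locale left_hom_leibniz_algebra = hom_algebra scale mult \<alpha>
  for scale :: "'k::field \<Rightarrow> 'a::ab_group_add \<Rightarrow> 'a"
    and mult :: "'a \<Rightarrow> 'a \<Rightarrow> 'a"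
    and \<alpha> :: "'a \<Rightarrow> 'a" +
  assumes left_hom_leibniz:
    "mult (\<alpha> x) (mult y z) = mult (mult x y) (\<alpha> z) + mult (\<alpha> y) (mult x z)"

definition commutator :: "('a \<Rightarrow> 'a \<Rightarrow> 'a) \<Rightarrow> 'a \<Rightarrow> 'a \<Rightarrow> 'a::ab_group_add" where
  "commutator mult x y = mult x y - mult y x"

end

theory Submission
  imports Defs
begin

context hom_algebra
begin

lemma mult_add_left: "mult (x + y) z = mult x z + mult y z"
  \<comment> \<open>The rule used here is stated for \<open>module_hom\<close>, so linearity in the
    left factor is first rewritten into that form.\<close>
  using module_hom.add[OF linear_mult_left[of z, unfolded module_hom_iff_linear[symmetric]]] .

lemma mult_diff_right: "mult x (y - z) = mult x y - mult x z"
  using module_hom.diff[OF linear_mult_right[of x, unfolded module_hom_iff_linear[symmetric]]] .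

end

context left_hom_leibniz_algebra
begin

text \<open>Add the Hom-Leibniz identities for \<open>(x, y, z)\<close> and \<open>(y, x, z)\<close>: the terms
  \<open>mult (\<alpha> x) (mult y z)\<close> and \<open>mult (\<alpha> y) (mult x z)\<close> cancel.\<close>

lemma symmetrized_mult_twist: "mult (mult x y + mult y x) (\<alpha> z) = 0"
  using left_hom_leibniz[of x y z] left_hom_leibniz[of y x z]
  by (simp add: mult_add_left flip: add.assoc)

text \<open>Subtracting the Hom-Leibniz identity at \<open>(x, z, y)\<close> from the one at
  \<open>(x, y, z)\<close> leaves four products. They pair up crosswise: each commutator on the
  right takes one term from either identity.\<close>

lemma twist_mult_commutator:
  "mult (\<alpha> x) (commutator mult y z)
    = commutator mult (mult x y) (\<alpha> z) + commutator mult (\<alpha> y) (mult x z)"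
  by (simp add: commutator_def mult_diff_right left_hom_leibniz[of x y z]
      left_hom_leibniz[of x z y] algebra_simps)

end

theorem proposition3p1:
  fixes scale :: "'k::field_char_0 \<Rightarrow> 'a::ab_group_add \<Rightarrow> 'a"
    and mult :: "'a \<Rightarrow> 'a \<Rightarrow> 'a" (infixl "\<cdot>" 70)
    and \<alpha> :: "'a \<Rightarrow> 'a"
  assumes "left_hom_leibniz_algebra scale mult \<alpha>"
  shows "(\<forall>x y z. (x \<cdot> y + y \<cdot> x) \<cdot> \<alpha> z = 0) \<and>
    (\<forall>x y z. \<alpha> x \<cdot> commutator mult y z
           = commutator mult (x \<cdot> y) (\<alpha> z) + commutator mult (\<alpha> y) (x \<cdot> z))"
  using left_hom_leibniz_algebra.symmetrized_mult_twist[OF assms]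
    left_hom_leibniz_algebra.twist_mult_commutator[OF assms] by blast

end
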